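(* Let $A\in\mathsf{S}^{k}(\mathbb{C}^{n})$. If $\operatorname{rank}_{\mathsf{S}}(A)\le n$, then generically $\operatorname{rank}(A)=\operatorname{rank}_{\mathsf{S}}(A)$. Precisely: for every integer $s\le n$ such that $\mathcal{Z}_s:=\{A\in\mathsf{S}^k(\mathbb{C}^n)\mid \operatorname{rank}_{\mathsf{S}}(A)=s\}$ is non-empty, there is a Zariski-closed proper subset $W\subsetneq\overline{\mathcal{Z}}_s$ of the Zariski closure of $\mathcal{Z}_s$ such that $\operatorname{rank}(A)=\operatorname{rank}_{\mathsf{S}}(A)$ for all $A\in\mathcal{Z}_s\setminus W$.
   Context: $\mathsf{T}^k(\mathbb{C}^n)=\mathbb{C}^n\otimes\cdots\otimes\mathbb{C}^n$ ($k$ copies), and $\mathsf{S}^k(\mathbb{C}^n)$ is its subspace of symmetric tensors (invariant under all permutations of the $k$ tensor factors). For $A\in\mathsf{T}^k(\mathbb{C}^n)$, $\operatorname{rank}(A)$ is the least $r\ge 0$ such that $A=\sum_{i=1}^r \mathbf{u}_i^{(1)}\otimes\cdots\otimes\mathbf{u}_i^{(k)}$ with $\mathbf{u}_i^{(j)}\in\mathbb{C}^n$. For $A\in\mathsf{S}^k(\mathbb{C}^n)$, $\operatorname{rank}_{\mathsf{S}}(A)$ is the least $s\ge 0$ such that $A=\sum_{i=1}^s\mathbf{y}_i^{\otimes k}$ with $\mathbf{y}_i\in\mathbb{C}^n$, where $\mathbf{y}^{\otimes k}=\mathbf{y}\otimes\cdots\otimes\mathbf{y}$ ($k$ copies). The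 zero tensor has rank $0$. *)

theory Defs
  imports "HOL-Analysis.Analysis"
begin

(* A tensor of order k = CARD('k) over C^n, n = CARD('n), is given by its coordinates in the
   standard basis: the multi-index f :: 'k => 'n picks one basis vector of C^n for each of the
   k tensor factors, which are labelled by 'k.  Types are non-empty, so k, n >= 1. *)

type_synonym ('n, 'k) tensor = "complex ^ ('k \<Rightarrow> 'n)"

definition tensor_prod :: "('k::finite \<Rightarrow> complex ^ 'n::finite) \<Rightarrow> ('n, 'k) tensor" where
  "tensor_prod u = (\<chi> f. \<Prod>j\<in>UNIV. u j $ f j)"

definition tensor_power :: "complex ^ 'n::finite \<Rightarrow> ('n, 'k::finite) tensor" where
  "tensor_power y = tensor_prod (\<lambda>_. y)"

definition symmetric_tensors :: "('n::finite, 'k::finite) tensor set" where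
  "symmetric_tensors = {A. \<forall>p. p permutes (UNIV :: 'k set) \<longrightarrow> (\<forall>f. A $ (f \<circ> p) = A $ f)}"

definition tensor_rank :: "('n::finite, 'k::finite) tensor \<Rightarrow> nat" where
  "tensor_rank A =
    (LEAST r. \<exists>u :: nat \<Rightarrow> 'k \<Rightarrow> complex ^ 'n. A = (\<Sum>i<r. tensor_prod (u i)))"

(* Only meaningful for symmetric A.  For those a decomposition always exists: by polarization the
   powers of vectors span the symmetric tensors, and scalars have k-th roots in C. *)
definition symmetric_rank :: "('n::finite, 'k::finite) tensor \<Rightarrow> nat" where
  "symmetric_rank A =
    (LEAST s. \<exists>y :: nat \<Rightarrow> complex ^ 'n. A = (\<Sum>i<s. tensor_power (y i)))"

definition symmetric_rank_locus :: "nat \<Rightarrow> ('n::finite, 'k::finite) tensor set" where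
  "symmetric_rank_locus s = {A \<in> symmetric_tensors. symmetric_rank A = s}"

inductive complex_polynomial_function :: "(complex ^ 'i::finite \<Rightarrow> complex) \<Rightarrow> bool" where
  coord: "complex_polynomial_function (\<lambda>x. x $ i)"
| const: "complex_polynomial_function (\<lambda>x. c)"
| add: "complex_polynomial_function p \<Longrightarrow> complex_polynomial_function q \<Longrightarrow>
    complex_polynomial_function (\<lambda>x. p x + q x)"
| mult: "complex_polynomial_function p \<Longrightarrow> complex_polynomial_function q \<Longrightarrow>
    complex_polynomial_function (\<lambda>x. p x * q x)"

(* The symmetric tensors are a linear subspace of the space of all tensors, cut out by linear
   equations, and polynomial functions on the subspace are restrictions of those on the whole
   space.  Hence for sets of symmetric tensors closedness and closure agree in both spaces. *)
definition zariski_closed :: "(complex ^ 'i::finite) set \<Rightarrow> bool" where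
  "zariski_closed V \<longleftrightarrow>
    (\<exists>P. (\<forall>p\<in>P. complex_polynomial_function p) \<and> V = {x. \<forall>p\<in>P. p x = 0})"

definition zariski_closure :: "(complex ^ 'i::finite) set \<Rightarrow> (complex ^ 'i) set" where
  "zariski_closure X = \<Inter>{V. zariski_closed V \<and> X \<subseteq> V}"

end

theory Submission
  imports Defs
begin

text \<open>
  The idea is that one determinant built from a flattening detects rank at least \<open>s\<close>. Singling out
  one of the \<open>k \<ge> 2\<close> tensor factors turns a tensor into a matrix whose rank is at most the tensor
  rank, since a product tensor flattens to a matrix of rank at most one. Restrict it to the
  columns in which all remaining factors carry the same index, let \<open>I\<close> be a set of
  \<open>s \<le> n\<close> basis indices, and let \<open>p A\<close> be the determinant of this square matrix after
  adding 1 to each diagonal entry outside \<open>I\<close>, a substitute for an \<open>s \<times> s\<close> minor.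
  Then \<open>p\<close> is a polynomial in the coordinates of \<open>A\<close>, and \<open>p A \<noteq> 0\<close> forces \<open>rank A \<ge> s\<close>
  (\<open>flattening_det_nonzero_imp_rank_ge\<close>). On tensors of symmetric rank \<open>s\<close> the
  opposite inequality holds because a symmetric decomposition is a decomposition, so both ranks agree
  wherever \<open>p\<close> does not vanish.

  The exceptional set is the Zariski closure of the zeros of \<open>p\<close> on the locus of symmetric rank
  \<open>s\<close>. It is proper because the sum of the powers of the basis vectors indexed by \<open>I\<close> has
  symmetric rank \<open>s\<close> and \<open>p\<close> takes the value 1 there.

  Two points need separate care. That the symmetric rank comes from an actual decomposition is the
  fact that powers span the symmetric tensors (\<open>symmetric_imp_sum_of_powers\<close>), which follows from
  polarization. And for \<open>k = 1\<close> there is no remaining factor to index the columns; but then every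
  product tensor is a power, and the two ranks coincide by definition.
\<close>

section \<open>Symmetric tensors are sums of powers\<close>

text \<open>
  Expanding \<open>\<Prod>x. (1 - c x)\<close> with \<open>c\<close> the indicator function of \<open>- R\<close>
  gives both sides. The summation variable is the complement of a superset of \<open>R\<close>, which is the form
  that the polarization identity consumes.
\<close>

lemma signed_sum_of_supersets:
  fixes R :: "'k::finite set"
  shows "(\<Sum>X\<in>UNIV. (-1) ^ card X * (if R \<subseteq> - X then 1 else 0)) =
           (if R = UNIV then 1 else (0 :: complex))"
proof -
  have "(\<Prod>x\<in>X. if x \<in> R then 0 else 1) = (if R \<subseteq> - X then 1 else (0 :: complex))"
    for X :: "'k set"
  proof (cases "R \<subseteq> - X")
    case True
    then show ?thesis by (auto intro!: prod.neutral)
  next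
    case False
    then show ?thesis by (auto intro!: prod_zero)
  qed
  moreover have "(\<Prod>x\<in>UNIV. 1 - (if x \<in> R then 0 else 1)) = (if R = UNIV then 1 else (0 :: complex))"
    by (cases "R = UNIV") (auto intro!: prod_zero)
  ultimately show ?thesis
    using prod_diff_conv_sum[of "UNIV :: 'k set" "\<lambda>_. 1 :: complex" "\<lambda>x. if x \<in> R then 0 else 1"]
    by simp
qed

text \<open>
  Multiplying out the power of \<open>\<Sum>l\<in>-X. u l\<close> yields one product tensor for each map
  \<open>g\<close> of the factors into \<open>- X\<close>. In the alternating sum over \<open>X\<close> the coefficient of
  \<open>g\<close> is the signed count of sets containing its range, so only surjective maps survive, and
  on a finite set these are the permutations.
\<close>

lemma polarization:
  fixes u :: "'k::finite \<Rightarrow> complex ^ 'n::finite"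
  shows "(\<Sum>p | p permutes UNIV. tensor_prod (\<lambda>j. u (p j))) =
           (\<Sum>X\<in>UNIV. (-1) ^ card X *s (tensor_power (\<Sum>l\<in>-X. u l) :: ('n, 'k) tensor))"
proof (rule vec_eq_iff[THEN iffD2], rule allI)
  fix f :: "'k \<Rightarrow> 'n"
  define m where "m g = (\<Prod>j\<in>UNIV. u (g j) $ f j)" for g
  have expand: "(\<Prod>j\<in>UNIV. \<Sum>l\<in>-X. u l $ f j) = (\<Sum>g\<in>UNIV. (if range g \<subseteq> - X then 1 else 0) * m g)"
    for X
  proof -
    have "(\<Prod>j\<in>UNIV. \<Sum>l\<in>-X. u l $ f j) = (\<Sum>g\<in>PiE UNIV (\<lambda>_. -X). m g)"
      unfolding m_def by (rule prod_sum_PiE) auto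
    also have "\<dots> = (\<Sum>g\<in>UNIV. if range g \<subseteq> - X then m g else 0)"
      by (rule sum.mono_neutral_cong_left) (auto simp: PiE_def Pi_def)
    finally show ?thesis by (simp add: if_distrib[of "\<lambda>x. x * _"] cong: if_cong)
  qed
  have "(\<Sum>X\<in>UNIV. (-1) ^ card X * (\<Prod>j\<in>UNIV. \<Sum>l\<in>-X. u l $ f j)) =
      (\<Sum>X\<in>UNIV. \<Sum>g\<in>UNIV. (-1) ^ card X * (if range g \<subseteq> - X then 1 else 0) * m g)"
    unfolding expand sum_distrib_left by (simp add: mult.assoc)
  also have "\<dots> = (\<Sum>g\<in>UNIV. (\<Sum>X\<in>UNIV. (-1) ^ card X * (if range g \<subseteq> - X then 1 else 0)) * m g)"
    by (subst sum.swap) (simp only: sum_distrib_right)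
  also have "\<dots> = (\<Sum>g\<in>UNIV. if surj g then m g else 0)"
    unfolding signed_sum_of_supersets by (rule sum.cong) auto
  also have "\<dots> = (\<Sum>p | p permutes UNIV. m p)"
  proof (rule sum.mono_neutral_cong_right)
    have "g permutes UNIV" if "surj g" for g :: "'k \<Rightarrow> 'k"
      using that finite_UNIV_surj_inj[of g] by (auto intro!: bij_imp_permutes simp: bij_def)
    then show "\<forall>g\<in>UNIV - {p. p permutes UNIV}. (if surj g then m g else 0) = 0" by auto
  qed (auto dest: permutes_surj)
  finally show "(\<Sum>p | p permutes UNIV. tensor_prod (\<lambda>j. u (p j))) $ f =
      (\<Sum>X\<in>UNIV. (-1) ^ card X *s (tensor_power (\<Sum>l\<in>-X. u l) :: ('n, 'k) tensor)) $ f"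
    by (simp add: tensor_power_def tensor_prod_def m_def)
qed

definition sum_of_powers :: "('n::finite, 'k::finite) tensor \<Rightarrow> bool" where
  "sum_of_powers A \<longleftrightarrow> (\<exists>ys. A = sum_list (map tensor_power ys))"

lemma sum_of_powers_add: "sum_of_powers A \<Longrightarrow> sum_of_powers B \<Longrightarrow> sum_of_powers (A + B)"
  unfolding sum_of_powers_def by (metis map_append sum_list_append)

lemma sum_of_powers_sum: "(\<And>x. x \<in> X \<Longrightarrow> sum_of_powers (F x)) \<Longrightarrow> sum_of_powers (sum F X)"
proof (induction X rule: infinite_finite_induct)
  case (insert x X)
  then show ?case by (simp add: sum_of_powers_add)
qed (auto simp: sum_of_powers_def intro!: exI[of _ "[]"])

lemma tensor_power_scale:
  "(tensor_power (c *s y) :: ('n::finite, 'k::finite) tensor) = c ^ CARD('k) *s tensor_power y"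
  by (simp add: tensor_power_def tensor_prod_def vec_eq_iff prod.distrib)

text \<open>
  Coefficients can be absorbed into the vectors because every complex number has a
  \<open>k\<close>-th root.
\<close>

lemma sum_of_powers_scaled_power:
  "sum_of_powers (c *s (tensor_power y :: ('n::finite, 'k::finite) tensor))"
proof -
  obtain d where "d ^ CARD('k) = c"
  proof (cases "c = 0")
    case True
    then show ?thesis using that[of 0] by simp
  next
    case False
    have "exp (ln c / of_nat CARD('k)) ^ CARD('k) = c"
      using False by (simp flip: exp_of_nat_mult)
    then show ?thesis by (rule that)
  qed
  then have "c *s (tensor_power y :: ('n, 'k) tensor) = sum_list (map tensor_power [d *s y])"
    by (simp add: tensor_power_scale)
  then show ?thesis unfolding sum_of_powers_def by blast
qed

lemma sum_of_powers_scale: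
  assumes "sum_of_powers A" shows "sum_of_powers (c *s A)"
proof -
  obtain ys where A: "A = sum_list (map tensor_power ys)"
    using assms unfolding sum_of_powers_def by blast
  have "c *s A = (\<Sum>i\<in>{0..<length ys}. c *s tensor_power (ys ! i))"
    unfolding A sum_list_sum_nth by (simp add: vec.scale_sum_right)
  then show ?thesis by (simp add: sum_of_powers_sum sum_of_powers_scaled_power)
qed

lemma prod_axis: "(\<Prod>j\<in>(UNIV :: 'k::finite set). axis (f j) (1 :: complex) $ g j) = (if f = g then 1 else 0)"
proof (cases "f = g")
  case False
  then obtain j where "f j \<noteq> g j" by auto
  then show ?thesis using False by (auto intro!: prod_zero bexI[of _ j] simp: axis_def)
qed (simp add: axis_def)

text \<open>
  Averaging the expansion of \<open>A\<close> in basis tensors over all permutations of the factors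
  leaves a symmetric \<open>A\<close> unchanged and replaces each basis tensor by a symmetrized one, to which
  polarization applies.
\<close>

lemma symmetric_imp_sum_of_powers:
  fixes A :: "('n::finite, 'k::finite) tensor"
  assumes "A \<in> symmetric_tensors"
  shows "sum_of_powers A"
proof -
  let ?P = "{p. p permutes (UNIV :: 'k set)}"
  define e where "e f = (tensor_prod (\<lambda>j. axis (f j) 1) :: ('n, 'k) tensor)" for f
  have "(\<Sum>f\<in>UNIV. A $ f *s (\<Sum>p\<in>?P. e (f \<circ> p))) = of_nat (card ?P) *s A"
  proof (rule vec_eq_iff[THEN iffD2], rule allI)
    fix g :: "'k \<Rightarrow> 'n"
    have inner: "(\<Sum>f\<in>UNIV. A $ f * (if f \<circ> p = g then 1 else 0)) = A $ g" if p: "p permutes UNIV" for p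
    proof -
      have "(f \<circ> p = g) = (f = g \<circ> inv p)" for f
        using permutes_bij[OF p] by (metis bij_is_inj bij_is_surj comp_assoc comp_id inv_o_cancel surj_iff)
      then have "(\<Sum>f\<in>UNIV. A $ f * (if f \<circ> p = g then 1 else 0)) = A $ (g \<circ> inv p)"
        by (simp add: if_distrib cong: if_cong)
      also have "\<dots> = A $ g"
        using assms permutes_inv[OF p] unfolding symmetric_tensors_def by blast
      finally show ?thesis .
    qed
    have "e f $ g = (if f = g then 1 else 0)" for f
      using prod_axis[of f g] by (simp add: e_def tensor_prod_def)
    then have "(\<Sum>f\<in>UNIV. A $ f *s (\<Sum>p\<in>?P. e (f \<circ> p))) $ g =
        (\<Sum>p\<in>?P. \<Sum>f\<in>UNIV. A $ f * (if f \<circ> p = g then 1 else 0))"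
      by (subst sum.swap) (simp only: sum_component vector_smult_component sum_distrib_left)
    also have "\<dots> = of_nat (card ?P) * A $ g"
      by (simp add: inner)
    finally show "(\<Sum>f\<in>UNIV. A $ f *s (\<Sum>p\<in>?P. e (f \<circ> p))) $ g = (of_nat (card ?P) *s A) $ g"
      by simp
  qed
  moreover have "card ?P \<noteq> 0"
    by (simp add: card_permutations[of "UNIV :: 'k set"])
  ultimately have "A = inverse (of_nat (card ?P)) *s (\<Sum>f\<in>UNIV. A $ f *s (\<Sum>p\<in>?P. e (f \<circ> p)))"
    by (simp add: vector_smult_assoc)
  moreover have "sum_of_powers (\<Sum>p\<in>?P. e (f \<circ> p))" for f
    unfolding e_def comp_def polarization[of "\<lambda>j. axis (f j) 1"]
    by (intro sum_of_powers_sum sum_of_powers_scaled_power)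
  then have "sum_of_powers (inverse (of_nat (card ?P)) *s
      (\<Sum>f\<in>UNIV. A $ f *s (\<Sum>p\<in>?P. e (f \<circ> p))))"
    by (rule sum_of_powers_scale[OF sum_of_powers_sum[OF sum_of_powers_scale]])
  ultimately show ?thesis by (simp only:)
qed

text \<open>
  The minimum defining the symmetric rank is attained because it ranges over a non-empty set.
\<close>

lemma symmetric_rank_decomposition:
  fixes A :: "('n::finite, 'k::finite) tensor"
  assumes "A \<in> symmetric_tensors"
  shows "\<exists>y. A = (\<Sum>i<symmetric_rank A. tensor_power (y i))"
proof -
  obtain ys where "A = sum_list (map tensor_power ys)"
    using symmetric_imp_sum_of_powers[OF assms] unfolding sum_of_powers_def by blast
  then have "A = (\<Sum>i<length ys. tensor_power (ys ! i))"
    by (simp add: sum_list_sum_nth atLeast0LessThan)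
  then have "\<exists>(s :: nat) y. A = (\<Sum>i<s. tensor_power (y i))"
    by blast
  then show ?thesis unfolding symmetric_rank_def by (rule LeastI_ex)
qed

lemma tensor_rank_le: "A = (\<Sum>i<r. tensor_prod (u i)) \<Longrightarrow> tensor_rank A \<le> r"
  unfolding tensor_rank_def by (rule Least_le) blast

lemma tensor_rank_le_symmetric_rank:
  assumes "A \<in> symmetric_tensors"
  shows "tensor_rank A \<le> symmetric_rank A"
proof -
  obtain y where "A = (\<Sum>i<symmetric_rank A. tensor_power (y i))"
    using symmetric_rank_decomposition[OF assms] by (elim exE)
  then show ?thesis unfolding tensor_power_def by (rule tensor_rank_le)
qed

lemma tensor_rank_decomposition:
  assumes "A \<in> symmetric_tensors"
  shows "\<exists>u. A = (\<Sum>i<tensor_rank A. tensor_prod (u i))"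
proof -
  obtain y where "A = (\<Sum>i<symmetric_rank A. tensor_prod (\<lambda>_. y i))"
    using symmetric_rank_decomposition[OF assms] unfolding tensor_power_def by (elim exE)
  then have "\<exists>u. A = (\<Sum>i<symmetric_rank A. tensor_prod (u i))"
    by (rule exI[of _ "\<lambda>i _. y i"])
  then have "\<exists>(r :: nat) u. A = (\<Sum>i<r. tensor_prod (u i))"
    by (rule exI)
  then show ?thesis unfolding tensor_rank_def by (rule LeastI_ex)
qed

section \<open>Flattening determinants as lower bounds for the rank\<close>

text \<open>
  The matrix is the sum of a matrix of rank at most \<open>r\<close> and a diagonal one of rank
  \<open>n - card I\<close>, so its range has dimension less than \<open>n\<close>.
\<close>

lemma det_low_rank_plus_partial_identity:
  fixes x z :: "nat \<Rightarrow> complex ^ 'n::finite"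
  assumes "r < card I"
  shows "det (\<chi> a b. (\<Sum>i<r. x i $ a * z i $ b) + (if a = b \<and> a \<notin> I then 1 else 0)) = 0"
    (is "det ?M = 0")
proof (rule ccontr)
  assume "det ?M \<noteq> 0"
  then have inv: "invertible ?M" by (simp add: invertible_det_nz)
  let ?B = "x ` {..<r} \<union> (\<lambda>a. axis a 1) ` (- I)"
  have in_span: "?M *v w \<in> vec.span ?B" for w
  proof -
    have "?M *v w = (\<Sum>i<r. (\<Sum>b\<in>UNIV. z i $ b * w $ b) *s x i) + (\<Sum>a\<in>-I. w $ a *s axis a 1)"
    proof (rule vec_eq_iff[THEN iffD2], rule allI)
      fix a
      have "(\<Sum>b\<in>UNIV. (\<Sum>i<r. x i $ a * z i $ b) * w $ b) =
          (\<Sum>i<r. (\<Sum>b\<in>UNIV. z i $ b * w $ b) * x i $ a)"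
        unfolding sum_distrib_right by (subst sum.swap) (simp add: mult_ac)
      moreover have "(\<Sum>b\<in>UNIV. (if a = b \<and> a \<notin> I then 1 else 0) * w $ b) =
          (\<Sum>c\<in>-I. w $ c * axis c 1 $ a)"
      proof -
        have "(\<Sum>b\<in>UNIV. (if a = b \<and> a \<notin> I then 1 else 0) * w $ b) = (if a \<notin> I then w $ a else 0)"
          by (simp add: if_distrib[of "\<lambda>x. x * _"] cong: if_cong)
        also have "\<dots> = (\<Sum>c\<in>-I. w $ c * axis c 1 $ a)"
          by (simp add: axis_def if_distrib[of "\<lambda>x. _ * x"] cong: if_cong)
        finally show ?thesis .
      qed
      ultimately show "(?M *v w) $ a =
          ((\<Sum>i<r. (\<Sum>b\<in>UNIV. z i $ b * w $ b) *s x i) + (\<Sum>a\<in>-I. w $ a *s axis a 1)) $ a"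
        by (simp add: matrix_vector_mult_def distrib_right sum.distrib)
    qed
    then show ?thesis
      by (auto intro!: vec.span_add vec.span_sum vec.span_scale intro: vec.span_base)
  qed
  obtain N where "?M ** N = mat 1"
    using inv unfolding invertible_def by blast
  then have mult_N: "?M *v (N *v v) = v" for v
    by (simp only: matrix_vector_mul_assoc matrix_vector_mul_lid)
  have "v \<in> vec.span ?B" for v
    using in_span[of "N *v v"] by (simp only: mult_N)
  then have "UNIV \<subseteq> vec.span ?B"
    by blast
  then have "vec.dim (UNIV :: (complex ^ 'n) set) \<le> card ?B" by (rule vec.dim_le_card) auto
  also have "\<dots> \<le> r + card (- I)"
    by (intro order_trans[OF card_Un_le] add_mono order_trans[OF card_image_le]) auto
  also have "\<dots> < CARD('n)"
    using assms card_mono[of UNIV I] by (simp add: Compl_eq_Diff_UNIV card_Diff_subset)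
  finally show False by (simp only: vec_dim_card less_irrefl)
qed

text \<open>
  A stand-in for the \<open>I \<times> I\<close> minor of the matrix whose rows are indexed by the index at
  factor \<open>j0\<close> and whose columns by the common index at all other factors. Adding ones on the
  diagonal outside \<open>I\<close> replaces the passage to a submatrix: the determinant always has size
  \<open>n\<close>, and the rank grows by at most \<open>n - card I\<close>.
\<close>

definition flattening_det :: "'k \<Rightarrow> 'n set \<Rightarrow> ('n::finite, 'k::finite) tensor \<Rightarrow> complex" where
  "flattening_det j0 I A =
     det (\<chi> a b. A $ (\<lambda>j. if j = j0 then a else b) + (if a = b \<and> a \<notin> I then 1 else 0))"

text \<open>
  A product tensor contributes a column at \<open>j0\<close> times a row from the other factors, so a
  tensor of rank \<open>r\<close> has a flattening of rank at most \<open>r\<close>.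
\<close>

lemma flattening_det_nonzero_imp_rank_ge:
  fixes A :: "('n::finite, 'k::finite) tensor"
  assumes "A \<in> symmetric_tensors" and "flattening_det j0 I A \<noteq> 0"
  shows "card I \<le> tensor_rank A"
proof (rule ccontr)
  let ?r = "tensor_rank A"
  assume "\<not> card I \<le> ?r"
  then have less: "?r < card I" by simp
  obtain u where u: "A = (\<Sum>i<?r. tensor_prod (u i))"
    using tensor_rank_decomposition[OF assms(1)] by (elim exE)
  have "A $ (\<lambda>j. if j = j0 then a else b) =
      (\<Sum>i<?r. u i j0 $ a * (\<chi> b. \<Prod>j\<in>UNIV - {j0}. u i j $ b) $ b)" for a b
  proof -
    have "tensor_prod (u i) $ (\<lambda>j. if j = j0 then a else b) =
        u i j0 $ a * (\<Prod>j\<in>UNIV - {j0}. u i j $ b)" for i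
      by (simp add: tensor_prod_def prod.remove[of UNIV j0])
    then show ?thesis by (subst u) simp
  qed
  then have "flattening_det j0 I A = 0"
    unfolding flattening_det_def
    using det_low_rank_plus_partial_identity[OF less, of "\<lambda>i. u i j0" "\<lambda>i. \<chi> b. \<Prod>j\<in>UNIV - {j0}. u i j $ b"]
    by simp
  with assms(2) show False by simp
qed

lemma complex_polynomial_function_sum:
  "(\<And>x. x \<in> X \<Longrightarrow> complex_polynomial_function (F x)) \<Longrightarrow>
    complex_polynomial_function (\<lambda>A. \<Sum>x\<in>X. F x A)"
  by (induction X rule: infinite_finite_induct) (simp_all add: complex_polynomial_function.intros)

lemma complex_polynomial_function_prod:
  "(\<And>x. x \<in> X \<Longrightarrow> complex_polynomial_function (F x)) \<Longrightarrow>
    complex_polynomial_function (\<lambda>A. \<Prod>x\<in>X. F x A)"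
  by (induction X rule: infinite_finite_induct) (simp_all add: complex_polynomial_function.intros)

lemma complex_polynomial_function_flattening_det:
  "complex_polynomial_function (flattening_det j0 I)"
  unfolding flattening_det_def[abs_def] det_def
  by (auto intro!: complex_polynomial_function_sum complex_polynomial_function_prod
      complex_polynomial_function.intros)

section \<open>Powers of basis vectors\<close>

lemma tensor_power_symmetric: "(tensor_power y :: ('n::finite, 'k::finite) tensor) \<in> symmetric_tensors"
proof -
  have "(\<Prod>j\<in>UNIV. y $ f (p j)) = (\<Prod>j\<in>UNIV. y $ f j)" if "p permutes UNIV" for p and f :: "'k \<Rightarrow> 'n"
    using prod.permute[OF that, of "\<lambda>j. y $ f j"] by (simp add: comp_def)
  then show ?thesis by (simp add: symmetric_tensors_def tensor_power_def tensor_prod_def)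
qed

lemma symmetric_tensors_sum:
  "(\<And>x. x \<in> X \<Longrightarrow> F x \<in> symmetric_tensors) \<Longrightarrow> sum F X \<in> symmetric_tensors"
  by (auto simp: symmetric_tensors_def intro!: sum.cong)

text \<open>
  With a second factor \<open>j1\<close> available, an entry at \<open>(a, b)\<close> can only be nonzero for
  \<open>a = b\<close>, so the flattening is diagonal with ones exactly on \<open>I\<close>; together with the
  added ones outside \<open>I\<close> this is the identity matrix. With a single factor the entries would
  not depend on \<open>b\<close>.
\<close>

lemma flattening_det_basis_powers:
  fixes j0 j1 :: "'k::finite"
  assumes "j1 \<noteq> j0"
  shows "flattening_det j0 I (\<Sum>i\<in>I. tensor_power (axis i 1) :: ('n::finite, 'k) tensor) = 1"
proof -
  have entry: "(tensor_power (axis i 1) :: ('n, 'k) tensor) $ (\<lambda>j. if j = j0 then a else b) =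
      (if i = a then if a = b then 1 else 0 else 0)" for a b i
  proof -
    have "(\<lambda>_. i) = (\<lambda>j. if j = j0 then a else b) \<longleftrightarrow> i = a \<and> a = b"
      using assms by (auto simp: fun_eq_iff)
    then show ?thesis
      using prod_axis[of "\<lambda>_ :: 'k. i" "\<lambda>j. if j = j0 then a else b"]
      by (simp add: tensor_power_def tensor_prod_def)
  qed
  have "(\<chi> a b. (\<Sum>i\<in>I. tensor_power (axis i 1) :: ('n, 'k) tensor) $ (\<lambda>j. if j = j0 then a else b)
      + (if a = b \<and> a \<notin> I then 1 else 0)) = (mat 1 :: complex ^ 'n ^ 'n)"
    by (simp add: vec_eq_iff entry mat_def)
  then show ?thesis by (simp add: flattening_det_def)
qed

text \<open>
  The obvious decomposition bounds the symmetric rank from above, and the flattening bounds the rank,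
  hence also the symmetric rank, from below.
\<close>

lemma basis_powers_in_symmetric_rank_locus:
  fixes j0 j1 :: "'k::finite"
  assumes "j1 \<noteq> j0"
  shows "(\<Sum>i\<in>I. tensor_power (axis i 1) :: ('n::finite, 'k) tensor) \<in> symmetric_rank_locus (card I)"
    (is "?E \<in> _")
proof -
  have sym: "?E \<in> symmetric_tensors"
    by (intro symmetric_tensors_sum tensor_power_symmetric)
  obtain h where h: "bij_betw h {..<card I} I"
    using ex_bij_betw_nat_finite[of I] by (auto simp: atLeast0LessThan)
  have "?E = (\<Sum>i<card I. tensor_power (axis (h i) 1))"
    by (simp add: sum.reindex_bij_betw[OF h, of "\<lambda>i. tensor_power (axis i 1)"])
  then have "symmetric_rank ?E \<le> card I"
    unfolding symmetric_rank_def by (intro Least_le) (rule exI)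
  moreover have "card I \<le> tensor_rank ?E"
    using flattening_det_nonzero_imp_rank_ge[OF sym, of j0 I]
    by (simp add: flattening_det_basis_powers[OF assms])
  ultimately show ?thesis
    using tensor_rank_le_symmetric_rank[OF sym] sym by (simp add: symmetric_rank_locus_def)
qed

section \<open>Zariski closures and the generic statement\<close>

lemma zariski_closed_Inter:
  assumes "\<And>V. V \<in> S \<Longrightarrow> zariski_closed V"
  shows "zariski_closed (\<Inter>S)"
proof -
  \<comment> \<open>Taking all polynomials that vanish on the intersection avoids choosing equations for each set.\<close>
  let ?P = "{p. complex_polynomial_function p \<and> (\<forall>x\<in>\<Inter>S. p x = 0)}"
  have "x \<in> V" if V: "V \<in> S" and x: "\<forall>p\<in>?P. p x = 0" for x V
  proof -
    obtain Q where Q: "\<forall>p\<in>Q. complex_polynomial_function p" "V = {x. \<forall>p\<in>Q. p x = 0}"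
      using assms[OF V] unfolding zariski_closed_def by (elim exE conjE)
    have "p x = 0" if "p \<in> Q" for p
    proof -
      have "\<forall>x\<in>V. p x = 0"
        unfolding Q(2) using that by simp
      then have "p \<in> ?P"
        using Q(1) V that by auto
      then show ?thesis using x by (rule bspec[rotated])
    qed
    then show ?thesis unfolding Q(2) by simp
  qed
  then have "\<Inter>S = {x. \<forall>p\<in>?P. p x = 0}"
    by (intro equalityI subsetI) auto
  then show ?thesis
    unfolding zariski_closed_def by (intro exI[of _ ?P]) simp
qed

lemma zariski_closed_closure: "zariski_closed (zariski_closure X)"
  unfolding zariski_closure_def by (rule zariski_closed_Inter) blast

lemma subset_zariski_closure: "X \<subseteq> zariski_closure X"
  unfolding zariski_closure_def by blast

lemma zariski_closure_mono: "X \<subseteq> Y \<Longrightarrow> zariski_closure X \<subseteq> zariski_closure Y"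
  unfolding zariski_closure_def by blast

text \<open>
  Applied to the flattening determinant, this keeps the exceptional set away from the sum of basis powers.
\<close>

lemma zariski_closure_subset_zeros:
  assumes "complex_polynomial_function p" and "\<And>x. x \<in> X \<Longrightarrow> p x = 0"
  shows "zariski_closure X \<subseteq> {x. p x = 0}"
proof -
  have "zariski_closed {x. p x = 0}"
    unfolding zariski_closed_def using assms(1) by (intro exI[of _ "{p}"]) auto
  moreover have "X \<subseteq> {x. p x = 0}"
    using assms(2) by (rule subsetI[OF CollectI])
  ultimately show ?thesis
    unfolding zariski_closure_def by (intro Inter_lower) simp
qed

lemma zariski_closed_empty: "zariski_closed {}"
  unfolding zariski_closed_def
  by (intro exI[of _ "{\<lambda>_. 1}"]) (auto intro: complex_polynomial_function.const)

lemma tensor_rank_eq_symmetric_rank_order_one: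
  fixes A :: "('n::finite, 'k::finite) tensor"
  assumes "\<And>j j' :: 'k. j = j'"
  shows "tensor_rank A = symmetric_rank A"
proof -
  \<comment> \<open>The unspecified index stands for the only factor there is.\<close>
  have "u = (\<lambda>_. u undefined)" for u :: "'k \<Rightarrow> complex ^ 'n"
    using assms[of _ undefined] by (auto intro!: arg_cong[of _ _ u])
  then have pow: "(tensor_prod u :: ('n, 'k) tensor) = tensor_power (u undefined)" for u
    unfolding tensor_power_def by (rule arg_cong)
  have "(\<exists>u :: nat \<Rightarrow> 'k \<Rightarrow> complex ^ 'n. A = (\<Sum>i<r. tensor_prod (u i))) =
      (\<exists>y. A = (\<Sum>i<r. tensor_power (y i)))" for r
  proof
    assume "\<exists>u :: nat \<Rightarrow> 'k \<Rightarrow> complex ^ 'n. A = (\<Sum>i<r. tensor_prod (u i))"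
    then obtain u :: "nat \<Rightarrow> 'k \<Rightarrow> complex ^ 'n" where "A = (\<Sum>i<r. tensor_prod (u i))"
      by blast
    then show "\<exists>y. A = (\<Sum>i<r. tensor_power (y i))"
      unfolding pow by (rule exI[of _ "\<lambda>i. u i undefined"])
  next
    assume "\<exists>y. A = (\<Sum>i<r. tensor_power (y i))"
    then obtain y where "A = (\<Sum>i<r. tensor_power (y i))"
      by blast
    then show "\<exists>u :: nat \<Rightarrow> 'k \<Rightarrow> complex ^ 'n. A = (\<Sum>i<r. tensor_prod (u i))"
      unfolding tensor_power_def by (rule exI[of _ "\<lambda>i _. y i"])
  qed
  then show ?thesis unfolding tensor_rank_def symmetric_rank_def by simp
qed

theorem proposition5p3:
  fixes s :: nat
  assumes "s \<le> CARD('n::finite)"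
    and "(symmetric_rank_locus s :: ('n, 'k::finite) tensor set) \<noteq> {}"
  shows "\<exists>W :: ('n, 'k) tensor set.
           zariski_closed W \<and> W \<subset> zariski_closure (symmetric_rank_locus s) \<and>
           (\<forall>A \<in> symmetric_rank_locus s - W. tensor_rank A = symmetric_rank A)"
proof (cases "\<exists>j0 j1 :: 'k. j1 \<noteq> j0")
  case False
  then have "tensor_rank A = symmetric_rank A" for A :: "('n, 'k) tensor"
    by (intro tensor_rank_eq_symmetric_rank_order_one) blast
  moreover have "{} \<subset> zariski_closure (symmetric_rank_locus s :: ('n, 'k) tensor set)"
    using assms(2) subset_zariski_closure by blast
  ultimately show ?thesis using zariski_closed_empty by blast
next
  case True
  then obtain j0 j1 :: 'k where j: "j1 \<noteq> j0" by blast
  obtain I :: "'n set" where I: "card I = s"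
    using obtain_subset_with_card_n[OF assms(1)] by blast
  let ?Z = "symmetric_rank_locus s :: ('n, 'k) tensor set"
  let ?E = "\<Sum>i\<in>I. tensor_power (axis i 1) :: ('n, 'k) tensor"
  define W where "W = zariski_closure {A \<in> ?Z. flattening_det j0 I A = 0}"
  have "W \<subseteq> {A. flattening_det j0 I A = 0}"
    unfolding W_def
    by (rule zariski_closure_subset_zeros) (auto intro: complex_polynomial_function_flattening_det)
  then have "?E \<notin> W"
    using flattening_det_basis_powers[OF j, of I] by auto
  moreover have "?E \<in> zariski_closure ?Z"
    using basis_powers_in_symmetric_rank_locus[OF j, of I] subset_zariski_closure I by blast
  moreover have "W \<subseteq> zariski_closure ?Z"
    unfolding W_def by (rule zariski_closure_mono) blast
  ultimately have "W \<subset> zariski_closure ?Z" by blast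
  moreover have "tensor_rank A = symmetric_rank A" if "A \<in> ?Z - W" for A
  proof (rule antisym)
    have A: "A \<in> symmetric_tensors" "symmetric_rank A = s"
      using that by (auto simp: symmetric_rank_locus_def)
    show "tensor_rank A \<le> symmetric_rank A"
      using A(1) by (rule tensor_rank_le_symmetric_rank)
    have "{A \<in> ?Z. flattening_det j0 I A = 0} \<subseteq> W"
      unfolding W_def by (rule subset_zariski_closure)
    then have "flattening_det j0 I A \<noteq> 0"
      using that by auto
    then have "card I \<le> tensor_rank A"
      by (rule flattening_det_nonzero_imp_rank_ge[OF A(1)])
    then show "symmetric_rank A \<le> tensor_rank A"
      using A(2) I by simp
  qed
  moreover have "zariski_closed W"
    unfolding W_def by (rule zariski_closed_closure)
  ultimately show ?thesis by blast
qed

end
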